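(* Let $N$ be a GA1 number with $\Omega(N)\ge 3$, and let $R=h(\log N)$, i.e. $R\ge 2$ is the real number with $2^R/R=\log N$. Then $N$ divides $$M:=\prod_{r=1}^{\lfloor R\rfloor}\ \prod_{p\le (r\log N)^{1/r}} p,$$ where the inner product is over primes $p$.
   Context: For an integer $n>1$ let $G(n)=\dfrac{\sigma(n)}{n\log\log n}$, where $\sigma(n)=\sum_{d\mid n}d$. A GA1 number is a composite integer $N$ such that $G(N)\ge G(N/p)$ for every prime $p$ dividing $N$. $\Omega(n)$ is the number of prime factors of $n$ counted with multiplicity. The function $t\mapsto 2^t/t$ is an increasing bijection of $[2,\infty)$ onto itself; $h:[2,\infty)\to[2,\infty)$ denotes its inverse, so $h(x)=t\iff x=2^t/t$. *)

theory Defs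
  imports Complex_Main "HOL-Computational_Algebra.Primes"
begin

definition divisor_sigma :: "nat \<Rightarrow> nat" where
  "divisor_sigma n = (\<Sum>d | d dvd n. d)"

text \<open>
  \<open>G n\<close> is only meaningful for \<open>n > 1\<close>. In that range the denominator is nonzero;
  it is negative exactly for \<open>n = 2\<close>.
\<close>

definition G :: "nat \<Rightarrow> real" where
  "G n = real (divisor_sigma n) / (real n * ln (ln (real n)))"

text \<open>
  For composite \<open>N\<close> and a prime divisor \<open>p\<close>, the division is exact and
  \<open>N div p > 1\<close>, so \<open>G\<close> is only used in its intended range.
\<close>

definition GA1 :: "nat \<Rightarrow> bool" where
  "GA1 N \<longleftrightarrow> N > 1 \<and> \<not> prime N \<and> (\<forall>p. prime p \<longrightarrow> p dvd N \<longrightarrow> G N \<ge> G (N div p))"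

definition bigomega :: "nat \<Rightarrow> nat" where
  "bigomega n = size (prime_factorization n)"

text \<open>
  The map below is a bijection of \<open>{2..}\<close> onto itself, so \<open>h x\<close> is the intended
  inverse for \<open>x \<ge> 2\<close> and unspecified otherwise. Every \<open>N\<close> with \<open>bigomega N \<ge> 3\<close>
  satisfies \<open>N \<ge> 8\<close>, hence \<open>ln N > 2\<close>.
\<close>

definition h :: "real \<Rightarrow> real" where
  "h = the_inv_into {2..} (\<lambda>t. 2 powr t / t)"

end

theory Submission
  imports Defs
begin

text \<open>
  Let \<open>L = ln N\<close> and let \<open>p\<close> divide \<open>N\<close> exactly \<open>k\<close> times. Since
  \<open>\<sigma>(N) / \<sigma>(N/p) = (1 + p + \<dots> + p^k) / (1 + p + \<dots> + p^(k-1))\<close>, the inequality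
  \<open>G(N/p) \<le> G(N)\<close> says \<open>(p + \<dots> + p^k) (ln (ln N) - ln (ln (N/p))) \<le> ln (ln (N/p))\<close>.
  The bound \<open>ln (1 - ln p / L) \<le> - ln p / L\<close> turns this into \<open>p^k ln p < L ln L\<close>.
  If \<open>p^s > s L\<close> for some \<open>1 \<le> s \<le> k\<close>, then \<open>p^k ln p \<ge> p^s ln (p^s) / s > L ln (s L) \<ge> L ln L\<close>,
  a contradiction. So \<open>p\<close> occurs in each of the first \<open>k\<close> factors of \<open>M\<close>, and these exist
  because \<open>2^k / k \<le> p^k / k \<le> L = 2^R / R\<close> gives \<open>k \<le> R\<close> when \<open>k > 2\<close>.
\<close>

section \<open>Divisor sums and the size of a number in terms of its prime factors\<close>

lemma divisor_sigma_pos: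
  assumes "n > 0"
  shows "divisor_sigma n > 0"
proof -
  have "n \<le> divisor_sigma n"
    unfolding divisor_sigma_def using finite_divisors_nat[OF assms] by (intro member_le_sum) auto
  then show ?thesis using assms by simp
qed

text \<open>Raising the exponent from \<open>k\<close> to \<open>Suc k\<close> adds exactly the
  divisors \<open>p ^ Suc k * d\<close> with \<open>d dvd m\<close>. None of them divides
  \<open>p ^ k * m\<close>, since that would force \<open>p dvd m\<close>.\<close>

lemma divisor_sigma_prime_power_mult:
  fixes p m k :: nat
  assumes p: "prime p" and m: "m > 0" "\<not> p dvd m"
  shows "divisor_sigma (p ^ k * m) = (\<Sum>i\<le>k. p ^ i) * divisor_sigma m"
proof (induction k)
  case 0
  show ?case by simp
next
  case (Suc k)
  let ?A = "{d. d dvd p ^ k * m}" and ?B = "(\<lambda>d. p ^ Suc k * d) ` {d. d dvd m}"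
  have p0: "p > 0" using p by (simp add: prime_gt_0_nat)
  have "{d. d dvd p ^ Suc k * m} = ?A \<union> ?B"
  proof (intro set_eqI iffI)
    fix d assume d: "d \<in> {d. d dvd p ^ Suc k * m}"
    then obtain a b where ab: "d = a * b" "a dvd p ^ Suc k" "b dvd m"
      using division_decomp[of d "p ^ Suc k" m] by auto
    then obtain i where i: "i \<le> Suc k" "a = p ^ i"
      using divides_primepow_nat[OF p] by blast
    show "d \<in> ?A \<union> ?B"
    proof (cases "i = Suc k")
      case True
      then show ?thesis using ab i by blast
    next
      case False
      then have "a dvd p ^ k" using i by (simp add: le_imp_power_dvd)
      then show ?thesis using ab by (simp add: mult_dvd_mono)
    qed
  next
    fix d assume "d \<in> ?A \<union> ?B"
    then show "d \<in> {d. d dvd p ^ Suc k * m}"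
      by (auto simp: mult.assoc intro: dvd_mult mult_dvd_mono)
  qed
  moreover have "?A \<inter> ?B = {}"
  proof -
    have False if "p ^ Suc k * d dvd p ^ k * m" for d
    proof -
      have "p ^ k * (p * d) dvd p ^ k * m" using that by (simp add: ac_simps)
      then have "p * d dvd m" using p0 by simp
      then show False using m(2) dvd_mult_left by blast
    qed
    then show ?thesis by blast
  qed
  moreover have "finite ?A" "finite ?B"
    using p0 m(1) by (auto intro: finite_divisors_nat)
  moreover have "inj_on (\<lambda>d. p ^ Suc k * d) {d. d dvd m}"
    using p0 by (auto intro!: inj_onI)
  ultimately have "divisor_sigma (p ^ Suc k * m) =
      divisor_sigma (p ^ k * m) + p ^ Suc k * divisor_sigma m"
    unfolding divisor_sigma_def by (simp only: sum.union_disjoint sum.reindex o_def sum_distrib_left)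
  then show ?case using Suc.IH by (simp add: algebra_simps)
qed

lemma power_bigomega_le:
  assumes "n > 0"
  shows "2 ^ bigomega n \<le> n"
proof -
  have "(\<forall>p \<in># A. prime p) \<Longrightarrow> 2 ^ size A \<le> prod_mset A" for A :: "nat multiset"
    by (induction A) (auto intro!: mult_mono simp: prime_ge_2_nat)
  from this[of "prime_factorization n"] show ?thesis
    using assms by (auto simp: bigomega_def prod_mset_prime_factorization_nat)
qed

lemma bigomega_div_prime:
  assumes "n > 0" "prime p" "p dvd n"
  shows "bigomega n = Suc (bigomega (n div p))"
proof -
  obtain q where q: "n = p * q" using assms by auto
  then have "prime_factorization n = add_mset p (prime_factorization q)"
    using assms by (simp add: prime_factorization_mult prime_factorization_prime)
  then show ?thesis using q assms by (simp add: bigomega_def prime_gt_0_nat)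
qed

section \<open>Logarithm estimates and the inverse \<open>h\<close>\<close>

lemma ln_2_gt_half: "ln (2::real) > 1 / 2"
proof -
  have "exp (1::real) < 4" using exp_le by simp
  then have "(1::real) < ln 4" by (metis exp_less_cancel_iff exp_ln zero_less_numeral)
  moreover have "ln (4::real) = 2 * ln 2" using ln_realpow[of "2::real" 2] by simp
  ultimately show ?thesis by simp
qed

text \<open>From \<open>exp 1 <= 3\<close> one only gets \<open>exp 2 <= 9\<close>. Instead
  \<open>1 + x <= exp x\<close> is applied at \<open>x = -1/16\<close> and raised to the power 32,
  which is sharp enough for \<open>exp (-2) > 1/8\<close>.\<close>

lemma ln_8_gt_2: "ln (8::real) > 2"
proof -
  have "(15 / 16 :: real) ^ 32 \<le> exp (- 1 / 16) ^ 32"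
    using exp_ge_add_one_self[of "- 1 / 16 :: real"] by (intro power_mono) auto
  also have "\<dots> = exp (- 2 :: real)"
    by (simp flip: exp_of_nat_mult)
  finally have "exp (- 2 :: real) \<ge> (15 / 16) ^ 32" .
  moreover have "(15 / 16 :: real) ^ 32 > 1 / 8" by (simp add: divide_simps)
  ultimately have "inverse (exp (2 :: real)) > inverse 8" by (simp add: exp_minus)
  then have "exp (2 :: real) < 8" by (simp add: field_simps)
  then show ?thesis by (metis exp_less_cancel_iff exp_ln zero_less_numeral)
qed

text \<open>\<open>ln 2 > 1/2\<close> makes \<open>t ln 2 - ln t\<close> increasing from \<open>t = 2\<close> on.\<close>

lemma two_powr_div_less:
  fixes s t :: real
  assumes "2 \<le> s" "s < t"
  shows "2 powr s / s < 2 powr t / t"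
proof -
  have "ln (t / s) \<le> t / s - 1" using assms by (intro ln_le_minus_one) auto
  also have "\<dots> = (t - s) / s" using assms by (simp add: field_simps)
  also have "\<dots> \<le> (t - s) / 2" using assms by (intro divide_left_mono) auto
  also have "\<dots> < (t - s) * ln 2"
    using assms mult_strict_left_mono[OF ln_2_gt_half, of "t - s"] by simp
  finally have "ln t - ln s < t * ln 2 - s * ln 2"
    using assms by (simp add: ln_div algebra_simps)
  then have "ln (2 powr s / s) < ln (2 powr t / t)"
    using assms by (simp add: ln_div ln_powr)
  then show ?thesis using assms by simp
qed

text \<open>\<open>the_inv_into\<close> is meaningful only on the image of an injective map. Strict
  monotonicity gives injectivity, and the intermediate value theorem, starting from the value 2 at
  \<open>t = 2\<close>, puts \<open>x\<close> in the image.\<close>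

lemma two_powr_div_h:
  assumes "x \<ge> 2"
  shows "h x \<ge> 2" "2 powr h x / h x = x"
proof -
  let ?f = "\<lambda>t::real. 2 powr t / t"
  have inj: "inj_on ?f {2..}"
    by (rule linorder_inj_onI') (use two_powr_div_less in fastforce)
  obtain n :: nat where n: "2 * x \<le> real n" using real_arch_simple by blast
  \<comment> \<open>With this right endpoint, \<open>2 powr b\<close> is the square of
    \<open>2 ^ n\<close>, hence at least \<open>n * n >= x * b\<close>.\<close>
  define b where "b = 2 * real n"
  have "x * (2 * real n) \<le> real n * real n" using mult_right_mono[OF n, of "real n"] by simp
  also have "\<dots> \<le> 2 ^ n * 2 ^ n"
    using of_nat_less_two_power[of n, where ?'a = real] by (intro mult_mono) auto
  also have "\<dots> = 2 powr b"
    using powr_add[of "2::real" "real n" "real n"] by (simp add: b_def powr_realpow)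
  finally have b: "x \<le> ?f b" "2 \<le> b"
    using n assms by (simp_all add: b_def field_simps)
  have "\<exists>t. 2 \<le> t \<and> t \<le> b \<and> ?f t = x"
    using assms b by (intro IVT') (auto intro!: continuous_intros)
  then have x: "x \<in> ?f ` {2..}" by auto
  show "h x \<ge> 2" using the_inv_into_into[OF inj x order_refl] by (simp add: h_def)
  show "2 powr h x / h x = x" using f_the_inv_into_f[OF inj x] by (simp add: h_def)
qed

section \<open>Bounds on the prime powers in a GA1 number\<close>

lemma GA1_prime_power_bound:
  fixes N p :: nat
  defines "L \<equiv> ln (real N)"
  assumes N: "GA1 N" "bigomega N \<ge> 3" and p: "prime p" "p dvd N"
  shows "real p ^ multiplicity p N * ln p < L * ln L"
proof -
  let ?k = "multiplicity p N"
  define A where "A = ln (ln (real (N div p)))"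
  have N0: "N > 0" using N by (simp add: GA1_def)
  have p2: "p \<ge> 2" using p by (simp add: prime_ge_2_nat)
  have pd: "p * (N div p) = N" using p by simp
  \<comment> \<open>At least two prime factors remain in \<open>N div p\<close>, so it is at least
    4, which exceeds \<open>exp 1\<close>. This makes the iterated logarithm \<open>A\<close>
    positive.\<close>
  have "2 ^ 2 \<le> (2::nat) ^ bigomega (N div p)"
    using bigomega_div_prime[OF N0 p] N(2) by (intro power_increasing) auto
  also have "\<dots> \<le> N div p"
    using N0 pd by (intro power_bigomega_le) (metis mult_0_right neq0_conv)
  finally have q4: "N div p \<ge> 4" by simp
  have "exp 1 < real (N div p)" using exp_le q4 by simp
  then have lnq: "ln (real (N div p)) > 1"
    by (metis exp_gt_zero exp_less_cancel_iff exp_ln less_trans)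
  then have A0: "A > 0" by (simp add: A_def)
  have "ln (real N) = ln (real p) + ln (real (N div p))"
    using p2 q4 by (subst pd[symmetric]) (simp add: ln_mult del: pd)
  then have lnq_eq: "ln (real (N div p)) = L - ln p" by (simp add: L_def)
  have lnp: "ln (real p) > 0" using p2 by simp
  have L1: "L > 1" using lnq lnq_eq lnp by simp
  \<comment> \<open>This gives \<open>ln L > 0\<close> for clearing denominators and, at the end,
    the strict inequality.\<close>
  have "A < ln L" unfolding A_def lnq_eq using lnq lnq_eq lnp by simp
  have "A - ln L = ln ((L - ln p) / L)"
    unfolding A_def lnq_eq using lnq lnq_eq L1 by (simp add: ln_div)
  also have "\<dots> \<le> (L - ln p) / L - 1"
    using lnq lnq_eq L1 by (intro ln_le_minus_one) simp
  also have "\<dots> = - ln p / L" using L1 by (simp add: field_simps)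
  finally have diff: "ln p / L \<le> ln L - A" by simp

  obtain m where m: "N = p ^ ?k * m" "\<not> p dvd m"
    using multiplicity_decompose'[of N p] N0 p(1) not_prime_unit[of p] by blast
  have m0: "m > 0" using m N0 by (metis mult_0_right neq0_conv)
  have k0: "?k > 0" using p N0 by (simp add: prime_multiplicity_gt_zero_iff)
  then obtain j where j: "?k = Suc j" using gr0_implies_Suc by blast
  define S where "S = (\<Sum>i\<le>j. p ^ i)"
  have qm: "N div p = p ^ j * m"
    using m(1) j p2 by (metis mult.assoc nonzero_mult_div_cancel_left not_numeral_le_zero power_Suc)
  have sig: "divisor_sigma N = (1 + p * S) * divisor_sigma m"
    "divisor_sigma (N div p) = S * divisor_sigma m"
  proof -
    show "divisor_sigma (N div p) = S * divisor_sigma m"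
      unfolding qm S_def by (rule divisor_sigma_prime_power_mult[OF p(1) m0 m(2)])
    have "divisor_sigma N = (\<Sum>i\<le>Suc j. p ^ i) * divisor_sigma m"
      using divisor_sigma_prime_power_mult[OF p(1) m0 m(2), of "Suc j"] m(1) j by simp
    also have "(\<Sum>i\<le>Suc j. p ^ i) = 1 + p * S"
      unfolding S_def by (subst sum.atMost_Suc_shift) (simp add: sum_distrib_left)
    finally show "divisor_sigma N = (1 + p * S) * divisor_sigma m" .
  qed
  have "p ^ j \<le> S" unfolding S_def by (rule member_le_sum) auto
  then have pS: "real p ^ ?k \<le> real p * S"
    using j by (simp add: mult_left_mono flip: of_nat_power of_nat_mult)
  have "G (N div p) \<le> G N" using N(1) p by (simp add: GA1_def)
  \<comment> \<open>Writing \<open>N\<close> as \<open>p * (N div p)\<close> lets both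
    \<open>N div p\<close> and \<open>divisor_sigma m\<close> cancel.\<close>
  then have "real S * divisor_sigma m / (real (N div p) * A)
    \<le> (1 + real p * S) * divisor_sigma m / (real p * real (N div p) * ln L)"
    unfolding G_def sig A_def[symmetric] L_def[symmetric] using pd
    by (simp add: distrib_right flip: of_nat_mult)
  moreover have "real (divisor_sigma m) > 0" using divisor_sigma_pos[OF m0] by simp
  moreover have "real (N div p) > 0" "real p > 0" using q4 p2 by simp_all
  ultimately have "real p * S * ln L \<le> (1 + real p * S) * A"
    using A0 \<open>A < ln L\<close> by (simp add: divide_simps) (simp add: mult_ac)
  then have "real p * S * (ln L - A) \<le> A" by (simp add: algebra_simps)
  moreover have "real p ^ ?k * (ln p / L) \<le> real p * S * (ln L - A)"
    using pS diff lnp L1 by (intro mult_mono) auto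
  ultimately have "real p ^ ?k * (ln p / L) < ln L" using \<open>A < ln L\<close> by simp
  then show ?thesis using L1 by (simp add: field_simps)
qed

lemma power_le_mult_of_power_mult_ln_less:
  fixes x L :: real
  assumes "x > 1" "L > 1" "x ^ k * ln x < L * ln L" "1 \<le> s" "s \<le> k"
  shows "x ^ s \<le> real s * L"
proof (rule ccontr)
  assume "\<not> ?thesis"
  then have gt: "real s * L < x ^ s" by simp
  have sL: "L \<le> real s * L" using mult_right_mono[of 1 "real s" L] assms by simp
  then have sL1: "1 \<le> real s * L" using assms by linarith
  have "real s * (L * ln L) \<le> (real s * L) * ln (real s * L)"
    using sL assms by (simp add: mult_left_mono)
  \<comment> \<open>\<open>t * ln t\<close> is monotone for \<open>t >= 1\<close>;
    \<open>sL1\<close> keeps \<open>ln (real s * L)\<close> nonnegative.\<close>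
  also have "\<dots> \<le> x ^ s * ln (x ^ s)"
    using gt sL1 assms by (intro mult_mono) auto
  also have "\<dots> = real s * (x ^ s * ln x)" using assms by (simp add: ln_realpow)
  also have "\<dots> \<le> real s * (x ^ k * ln x)"
    using assms by (intro mult_left_mono mult_right_mono power_increasing) auto
  finally have "L * ln L \<le> x ^ k * ln x" using assms by simp
  then show False using assms by simp
qed

theorem theorem11:
  fixes N :: nat and R :: real
  assumes "GA1 N"
    and "bigomega N \<ge> 3"
    and "R = h (ln (real N))"
  shows "N dvd (\<Prod>r = 1..nat \<lfloor>R\<rfloor>.
           \<Prod>p | prime p \<and> real p \<le> (real r * ln (real N)) powr (1 / real r). p)"
proof -
  define L where "L = ln (real N)"
  define P where "P r = {p::nat. prime p \<and> real p \<le> (real r * L) powr (1 / real r)}" for r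
  let ?M = "\<Prod>r = 1..nat \<lfloor>R\<rfloor>. \<Prod>(P r)"
  have N0: "N > 0" using assms(1) by (simp add: GA1_def)
  have "2 ^ 3 \<le> (2::nat) ^ bigomega N" using assms(2) by (intro power_increasing) auto
  also have "\<dots> \<le> N" using N0 by (rule power_bigomega_le)
  finally have "ln 8 \<le> L" unfolding L_def using N0 by simp
  then have L2: "L > 2" using ln_8_gt_2 by simp
  have R: "R \<ge> 2" "2 powr R / R = L"
    using two_powr_div_h[of L] L2 assms(3) by (simp_all add: L_def)
  \<comment> \<open>A product over an infinite set is 1 by default, so finiteness is what lets each
    member of \<open>P r\<close> divide \<open>\<Prod>(P r)\<close>.\<close>
  have finP: "finite (P r)" for r
    by (rule finite_subset[of _ "{..nat \<lfloor>(real r * L) powr (1 / real r)\<rfloor>}"])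
      (auto simp: P_def le_nat_floor)
  \<comment> \<open>Zero has multiplicity 0 by convention, so comparing multiplicities with
    \<open>?M\<close> requires \<open>?M\<close> to be nonzero.\<close>
  have "prod (\<lambda>r. \<Prod>(P r)) {1..nat \<lfloor>R\<rfloor>} \<noteq> 0"
    using finP by (auto simp: P_def)
  moreover have "p ^ multiplicity p N dvd ?M" if p: "prime p" "p dvd N" for p
  proof -
    let ?k = "multiplicity p N"
    have p2: "p \<ge> 2" using p by (simp add: prime_ge_2_nat)
    have k: "?k > 0" using p N0 by (simp add: prime_multiplicity_gt_zero_iff)
    have ps: "real p ^ s \<le> real s * L" if "1 \<le> s" "s \<le> ?k" for s
      using GA1_prime_power_bound[OF assms(1,2) p] that p2 L2
      by (intro power_le_mult_of_power_mult_ln_less[of _ _ ?k]) (auto simp: L_def)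
    have "real ?k \<le> R"
    proof (rule ccontr)
      assume gt: "\<not> real ?k \<le> R"
      have "2 ^ ?k \<le> real p ^ ?k" using p2 by (intro power_mono) auto
      also have "\<dots> \<le> real ?k * L" using ps k by simp
      finally have "2 powr real ?k / real ?k \<le> L"
        using k by (simp add: powr_realpow field_simps)
      \<comment> \<open>Monotonicity is available from 2 on, and here \<open>2 <= R < ?k\<close>;
        exponents up to 2 thus need no separate case.\<close>
      with two_powr_div_less[of R ?k] gt R show False by simp
    qed
    then have kR: "?k \<le> nat \<lfloor>R\<rfloor>" by (simp add: le_nat_floor)
    have mem: "p \<in> P s" if s: "s \<in> {1..?k}" for s
    proof -
      have "real p = (real p ^ s) powr (1 / real s)"
        using s p2 by (simp add: powr_powr flip: powr_realpow)
      also have "\<dots> \<le> (real s * L) powr (1 / real s)"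
        using ps[of s] s by (intro powr_mono2) auto
      finally show ?thesis using p by (simp add: P_def)
    qed
    have "p ^ ?k = (\<Prod>s\<in>{1..?k}. p)" by simp
    also have "\<dots> dvd (\<Prod>s\<in>{1..?k}. \<Prod>(P s))"
      using mem finP by (intro prod_dvd_prod dvd_prodI) auto
    also have "\<dots> dvd ?M"
      using kR by (intro prod_dvd_prod_subset) auto
    finally show ?thesis .
  qed
  then have "p ^ multiplicity p N dvd ?M" if "prime p" for p
    using that by (cases "p dvd N") (simp_all add: not_dvd_imp_multiplicity_0)
  ultimately have "N dvd ?M"
    using N0 by (intro multiplicity_le_imp_dvd) (auto intro!: multiplicity_geI not_prime_unit)
  then show ?thesis by (simp add: P_def L_def)
qed

end
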